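(* Let $H$ be the simple undirected graph with the $7$ vertices $A,B,C,D,E,F,G$ and the $10$ edges $$\{A,B\},\ \{A,C\},\ \{A,E\},\ \{A,G\},\ \{B,C\},\ \{C,D\},\ \{D,E\},\ \{D,G\},\ \{E,F\},\ \{F,G\}.$$ Then $H$ satisfies $\mathrm{CD}(0,\infty)$, but $H$ does not satisfy $\mathrm{CD}(0,n)$ for any $n\in(0,\infty)$.
   Context: For a locally finite graph with vertex set $V$ and edge set $\mathcal{E}$, write $N_x=\{y\in V:\{x,y\}\in \mathcal{E}\}$. The Laplacian acts on $f\in\mathbb{R}^V$ by $\Delta f(x)=\sum_{y\in N_x}(f(y)-f(x))$. For $f,g\in\mathbb{R}^V$, set $\Gamma_0(f,g)=fg$ and, for $k\ge 1$, $$\Gamma_k(f,g)=\tfrac12\left(\Delta\Gamma_{k-1}(f,g)-\Gamma_{k-1}(f,\Delta g)-\Gamma_{k-1}(g,\Delta f)\right).$$ For $\kappa\in\mathbb{R}$ and $n\in(0,\infty]$, the graph satisfies $\mathrm{CD}(\kappa,n)$ if for all $f\in\mathbb{R}^V$ and all $x\in V$, $$\Gamma_2(f,f)(x)\ge \kappa\,\Gamma_1(f,f)(x)+\frac{(\Delta f(x))^2}{n},$$ with the convention that the last term is $0$ when $n=\infty$. *)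

theory Defs
  imports "HOL-Library.Extended_Real"
begin

text \<open>
  The vertex set \<open>V\<close> is the type \<open>'v\<close>, so that \<open>\<real>\<^sup>V\<close> is \<open>'v \<Rightarrow> real\<close>; an edge is an unordered
  pair of distinct vertices.
\<close>

locale locally_finite_graph =
  fixes edges :: "'v set set"
  assumes card_edge: "e \<in> edges \<Longrightarrow> card e = 2"
    and locally_finite: "finite {y. {x, y} \<in> edges}"
begin

definition nbrs :: "'v \<Rightarrow> 'v set"
  where "nbrs x = {y. {x, y} \<in> edges}"

definition \<Delta> :: "('v \<Rightarrow> real) \<Rightarrow> 'v \<Rightarrow> real"
  where "\<Delta> f x = (\<Sum>y\<in>nbrs x. f y - f x)"

primrec \<Gamma> :: "nat \<Rightarrow> ('v \<Rightarrow> real) \<Rightarrow> ('v \<Rightarrow> real) \<Rightarrow> 'v \<Rightarrow> real"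
  where
    "\<Gamma> 0 f g = (\<lambda>x. f x * g x)"
  | "\<Gamma> (Suc k) f g = (\<lambda>x. 1/2 * (\<Delta> (\<Gamma> k f g) x - \<Gamma> k f (\<Delta> g) x - \<Gamma> k g (\<Delta> f) x))"

text \<open>Only meaningful for dimensions \<open>n\<close> with \<open>0 < n \<le> \<infinity>\<close>.\<close>

definition CD :: "real \<Rightarrow> ereal \<Rightarrow> bool"
  where "CD \<kappa> n \<longleftrightarrow>
    (\<forall>f x. \<Gamma> 2 f f x \<ge> \<kappa> * \<Gamma> 1 f f x + (if n = \<infinity> then 0 else (\<Delta> f x)\<^sup>2 / real_of_ereal n))"

end

datatype vertex = A | B | C | D | E | F | G

definition H_edges :: "vertex set set"
  where "H_edges =
    {{A, B}, {A, C}, {A, E}, {A, G}, {B, C}, {C, D}, {D, E}, {D, G}, {E, F}, {F, G}}"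

lemma finite_vertex_set: "finite (S :: vertex set)"
proof (rule finite_subset)
  show "S \<subseteq> {A, B, C, D, E, F, G}"
    using vertex.exhaust by blast
qed simp

global_interpretation H: locally_finite_graph H_edges
proof
  show "card e = 2" if "e \<in> H_edges" for e
    using that by (auto simp: H_edges_def)
  show "finite {y. {x, y} \<in> H_edges}" for x
    by (rule finite_vertex_set)
qed

end

theory Submission
  imports Defs
begin

text \<open>
  For each vertex \<open>x\<close>, \<open>\<Gamma>\<^sub>2(f,f)(x)\<close> is a quadratic form in the differences \<open>f v - f x\<close>. Gaussian
  elimination, starting with the vertices at distance two from \<open>x\<close>, writes each of the seven
  forms as a sum of squares, which gives \<open>CD(0,\<infinity>)\<close>. The form at \<open>A\<close> degenerates on
  the function with values \<open>(0, -2, -1, 2, 2, 4, 2)\<close> at \<open>(A, \<dots>, G)\<close>, whose Laplacian at \<open>A\<close> is \<open>1\<close>;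
  this excludes every finite dimension.
\<close>

context locally_finite_graph
begin

text \<open>Termwise this is ab - cd - c(b - d) - d(a - c) = (a - c)(b - d).\<close>

lemma Gamma_1: "\<Gamma> 1 f g x = (\<Sum>y\<in>nbrs x. (f y - f x) * (g y - g x)) / 2"
proof -
  have "\<Gamma> 1 f g x = (\<Sum>y\<in>nbrs x. f y * g y - f x * g x - f x * (g y - g x) - g x * (f y - f x)) / 2"
    by (simp add: \<Delta>_def sum_distrib_left sum_subtractf right_diff_distrib
        flip: sum_divide_distrib)
  also have "\<dots> = (\<Sum>y\<in>nbrs x. (f y - f x) * (g y - g x)) / 2"
    by (simp add: algebra_simps)
  finally show ?thesis .
qed

lemma Gamma_2: "\<Gamma> 2 f f x = (\<Sum>y\<in>nbrs x. \<Gamma> 1 f f y - \<Gamma> 1 f f x) / 2 - \<Gamma> 1 f (\<Delta> f) x"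
proof -
  have "\<Gamma> 2 f f x = 1/2 * (\<Delta> (\<Gamma> 1 f f) x - \<Gamma> 1 f (\<Delta> f) x - \<Gamma> 1 f (\<Delta> f) x)"
    by (simp only: numeral_2_eq_2 One_nat_def \<Gamma>.simps(2)[of "Suc 0"])
  then show ?thesis
    by (simp only: \<Delta>_def[of "\<Gamma> 1 f f"]) (simp add: field_simps)
qed

end

lemma H_nbrs:
  "H.nbrs A = {B, C, E, G}"
  "H.nbrs B = {A, C}"
  "H.nbrs C = {A, B, D}"
  "H.nbrs D = {C, E, G}"
  "H.nbrs E = {A, D, F}"
  "H.nbrs F = {E, G}"
  "H.nbrs G = {A, D, F}"
  unfolding H.nbrs_def by (auto simp: H_edges_def doubleton_eq_iff)

lemmas H_expand = H.Gamma_2 H.Gamma_1 H.\<Delta>_def H_nbrs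

text \<open>Completing the square: a vertex z at distance two from the centre, with m common
  neighbours y, enters only through m/4 times the square of d z - (2/m) * (sum of the d y). Here m
  is 3 for \<open>D\<close> and 2 for \<open>F\<close>. What remains is a form in the neighbours
  alone. The other six lemmas follow the same pattern.\<close>

lemma H_Gamma_2_A:
  fixes f :: "vertex \<Rightarrow> real"
  defines "d \<equiv> \<lambda>v. f v - f A"
  shows "H.\<Gamma> 2 f f A =
    1/12 * (3 * d D - 2 * d C - 2 * d E - 2 * d G)\<^sup>2 +
    1/2 * (d F - d E - d G)\<^sup>2 +
    1/20 * (5 * d B - 2 * d C + 2 * d E + 2 * d G)\<^sup>2 +
    11/120 * (4 * d C + d E + d G)\<^sup>2 +
    5/8 * (d E - d G)\<^sup>2"
  by (simp add: H_expand d_def field_simps power2_eq_square)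

lemma H_Gamma_2_B:
  fixes f :: "vertex \<Rightarrow> real"
  defines "d \<equiv> \<lambda>v. f v - f B"
  shows "H.\<Gamma> 2 f f B =
    1/4 * (d D - 2 * d C)\<^sup>2 +
    1/4 * (d E - 2 * d A)\<^sup>2 +
    1/4 * (d G - 2 * d A)\<^sup>2 +
    1/20 * (5 * d A - 2 * d C)\<^sup>2 +
    13/10 * (d C)\<^sup>2"
  by (simp add: H_expand d_def field_simps power2_eq_square)

lemma H_Gamma_2_C:
  fixes f :: "vertex \<Rightarrow> real"
  defines "d \<equiv> \<lambda>v. f v - f C"
  shows "H.\<Gamma> 2 f f C =
    1/2 * (d E - d A - d D)\<^sup>2 +
    1/2 * (d G - d A - d D)\<^sup>2 +
    1/8 * (4 * d A - d B - d D)\<^sup>2 +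
    1/88 * (11 * d B + 3 * d D)\<^sup>2 +
    17/22 * (d D)\<^sup>2"
  by (simp add: H_expand d_def field_simps power2_eq_square)

lemma H_Gamma_2_D:
  fixes f :: "vertex \<Rightarrow> real"
  defines "d \<equiv> \<lambda>v. f v - f D"
  shows "H.\<Gamma> 2 f f D =
    1/12 * (3 * d A - 2 * d C - 2 * d E - 2 * d G)\<^sup>2 +
    1/4 * (d B - 2 * d C)\<^sup>2 +
    1/2 * (d F - d E - d G)\<^sup>2 +
    1/24 * (4 * d C + d E + d G)\<^sup>2 +
    1/8 * (3 * d E - d G)\<^sup>2 +
    (d G)\<^sup>2"
  by (simp add: H_expand d_def field_simps power2_eq_square)

lemma H_Gamma_2_E:
  fixes f :: "vertex \<Rightarrow> real"
  defines "d \<equiv> \<lambda>v. f v - f E"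
  shows "H.\<Gamma> 2 f f E =
    1/4 * (d B - 2 * d A)\<^sup>2 +
    1/2 * (d C - d A - d D)\<^sup>2 +
    1/12 * (3 * d G - 2 * d A - 2 * d D - 2 * d F)\<^sup>2 +
    1/132 * (11 * d A - 4 * d D + 2 * d F)\<^sup>2 +
    1/506 * (23 * d D + 5 * d F)\<^sup>2 +
    77/92 * (d F)\<^sup>2"
  by (simp add: H_expand d_def field_simps power2_eq_square)

lemma H_Gamma_2_F:
  fixes f :: "vertex \<Rightarrow> real"
  defines "d \<equiv> \<lambda>v. f v - f F"
  shows "H.\<Gamma> 2 f f F =
    1/2 * (d A - d E - d G)\<^sup>2 +
    1/2 * (d D - d E - d G)\<^sup>2 +
    1/20 * (5 * d E - 2 * d G)\<^sup>2 +
    21/20 * (d G)\<^sup>2"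
  by (simp add: H_expand d_def field_simps power2_eq_square)

text \<open>Swapping \<open>E\<close> and \<open>G\<close> is an automorphism of the graph, so this
  is the form at \<open>E\<close> with \<open>d G\<close> replaced by \<open>d E\<close>.\<close>

lemma H_Gamma_2_G:
  fixes f :: "vertex \<Rightarrow> real"
  defines "d \<equiv> \<lambda>v. f v - f G"
  shows "H.\<Gamma> 2 f f G =
    1/4 * (d B - 2 * d A)\<^sup>2 +
    1/2 * (d C - d A - d D)\<^sup>2 +
    1/12 * (3 * d E - 2 * d A - 2 * d D - 2 * d F)\<^sup>2 +
    1/132 * (11 * d A - 4 * d D + 2 * d F)\<^sup>2 +
    1/506 * (23 * d D + 5 * d F)\<^sup>2 +
    77/92 * (d F)\<^sup>2"
  by (simp add: H_expand d_def field_simps power2_eq_square)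

theorem lemma3:
  shows "H.CD 0 \<infinity> \<and> (\<forall>n\<in>{0<..<\<infinity>}. \<not> H.CD 0 n)"
proof (intro conjI ballI)
  have "H.\<Gamma> 2 f f x \<ge> 0" for f x
    by (cases x)
      (simp_all only: H_Gamma_2_A H_Gamma_2_B H_Gamma_2_C H_Gamma_2_D H_Gamma_2_E H_Gamma_2_F H_Gamma_2_G, simp_all)
  then show "H.CD 0 \<infinity>"
    by (simp add: H.CD_def)
next
  fix n :: ereal
  assume n: "n \<in> {0<..<\<infinity>}"
  \<comment> \<open>The five squares at \<open>A\<close> are of independent linear forms in six
    differences, so their common kernel is a line. Back-substitution from
    \<open>d E = d G = 2\<close> gives this spanning vector.\<close>
  define f :: "vertex \<Rightarrow> real" where
    "f = (\<lambda>v. case v of A \<Rightarrow> 0 | B \<Rightarrow> -2 | C \<Rightarrow> -1 | D \<Rightarrow> 2 | E \<Rightarrow> 2 | F \<Rightarrow> 4 | G \<Rightarrow> 2)"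
  have "H.\<Gamma> 2 f f A = 0" "H.\<Delta> f A = 1"
    by (simp_all add: H_Gamma_2_A H.\<Delta>_def H_nbrs f_def)
  \<comment> \<open>Together these make \<open>real_of_ereal n\<close> positive, so the inequality
    at \<open>A\<close> would read 0 \<ge> 1/n.\<close>
  moreover have "0 < n" "n \<noteq> \<infinity>"
    using n by simp_all
  ultimately have "\<not> H.\<Gamma> 2 f f A \<ge> 0 * H.\<Gamma> 1 f f A +
      (if n = \<infinity> then 0 else (H.\<Delta> f A)\<^sup>2 / real_of_ereal n)"
    by (simp add: not_le)
  then show "\<not> H.CD 0 n"
    unfolding H.CD_def by blast
qed

end
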